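(* Let $X$ be a metric space. The set $\mathrm{AC}_{\mathrm{inv}}(X)$ of invertible asymptotically conservative mappings of $X$ to itself is a monoid with respect to composition of mappings. Furthermore, the relation "closeness at infinity" is a semigroup congruence on $\mathrm{AC}_{\mathrm{inv}}(X)$, and the quotient semigroup $\mathfrak{AC}(X)=\mathrm{AC}_{\mathrm{inv}}(X)/(\text{close at infinity})$ is a group.
   Context: All metric spaces are assumed to have infinite diameter. For a metric space $(X,d_X)$ with reference point $x_0$, the Gromov product is $\langle x_1|x_2\rangle=\frac12\big(d_X(x_0,x_1)+d_X(x_0,x_2)-d_X(x_1,x_2)\big)$, and for sequences $\mathbf{x}=\{x_n\}$, $\mathbf{y}=\{y_n\}$ in $X$ one sets $\langle\mathbf{x}|\mathbf{y}\rangle=\liminf_{n,m\to\infty}\langle x_n|y_m\rangle$; whether this equals $\infty$ does not depend on $x_0$. $\mathrm{USq}(X)$ is the set of unbounded sequences in $X$; $\mathrm{Sq}^\infty(X)=\{\mathbf{x}\in\mathrm{USq}(X):\langle\mathbf{x}|\mathbf{x}\rangle=\infty\}$; for $\mathbf{x}\in X^{\mathbb N}$, $\mathrm{Vis}(\mathbf{x})=\{\mathbf{y}\in\mathrm{Sq}^\infty(X):\langle\mathbf{y}|\mathbf{x}\rangle=\infty\}$. For $\omega:X\to Y$, $\omega(\mathbf{x})=\{\omega(x_n)\}$ and $\omega(E)=\{\omega(\mathbf{x}):\mathbf{x}\in E\}$ for $E\subset X^{\mathbb N}$. A mapping $\omega:X\to Y$ of metric spaces (no continuity assumed) is asymptotically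 conservative if for every $\mathbf{x}\in\mathrm{USq}(X)$: (1) $\omega(\mathrm{Vis}(\mathbf{x}))\subset\mathrm{Vis}(\omega(\mathbf{x}))$; (2) for every $\mathbf{z}\in\mathrm{USq}(X)$, if $\omega(\mathbf{z})\in\mathrm{Vis}(\omega(\mathbf{x}))$ then $\mathbf{z}\in\mathrm{Vis}(\mathbf{x})$. Two mappings $\omega_1,\omega_2:X\to Y$ are close at infinity if for all $\mathbf{x}^1,\mathbf{x}^2\in\mathrm{Sq}^\infty(X)$, $\mathrm{Vis}(\mathbf{x}^1)=\mathrm{Vis}(\mathbf{x}^2)$ implies $\mathrm{Vis}(\omega_1(\mathbf{x}^1))=\mathrm{Vis}(\omega_2(\mathbf{x}^2))$. An asymptotically conservative $\omega:X\to Y$ is invertible if there is an asymptotically conservative $\omega':Y\to X$ (an asymptotic quasi-inverse) such that $\omega'\circ\omega$ and $\omega\circ\omega'$ are close at infinity to the identity mappings of $X$ and $Y$ respectively. A semigroup congruence on a semigroup $G$ is an equivalence relation $\sim$ such that $x\sim y$ and $z\sim w$ imply $xz\sim yw$; the quotient semigroup $G/\sim$ has product $[g_1][g_2]=[g_1g_2]$. *)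

theory Defs
  imports "HOL-Analysis.Analysis" "HOL-Algebra.Group"
begin

definition gromov_product :: "'a::metric_space \<Rightarrow> 'a \<Rightarrow> 'a \<Rightarrow> real" where
  "gromov_product x0 x y = (dist x0 x + dist x0 y - dist x y) / 2"

definition gromov_product_seq ::
    "'a::metric_space \<Rightarrow> (nat \<Rightarrow> 'a) \<Rightarrow> (nat \<Rightarrow> 'a) \<Rightarrow> ereal" where
  "gromov_product_seq x0 x y =
     Liminf (sequentially \<times>\<^sub>F sequentially) (\<lambda>(n, m). ereal (gromov_product x0 (x n) (y m)))"

text \<open>
  The reference point is kept as an explicit parameter of everything below; by the following
  lemma none of the notions depends on it.
\<close>

lemma gromov_product_seq_infinite_basepoint:
  fixes x0 x1 :: "'a::metric_space"
  shows "gromov_product_seq x0 x y = \<infinity> \<longleftrightarrow> gromov_product_seq x1 x y = \<infinity>"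
proof -
  have imp: "gromov_product_seq q x y = \<infinity>" if inf: "gromov_product_seq p x y = \<infinity>" for p q :: 'a
  proof -
    let ?F = "sequentially \<times>\<^sub>F sequentially :: (nat \<times> nat) filter"
    have "gromov_product p u v - dist p q \<le> gromov_product q u v" for u v
      using dist_triangle[of p u q] dist_triangle[of p v q]
      by (simp add: gromov_product_def field_simps)
    then have "ereal (gromov_product p u v) + ereal (- dist p q) \<le> ereal (gromov_product q u v)" for u v
      by simp
    then have le: "Liminf ?F (\<lambda>(n, m). ereal (gromov_product p (x n) (y m)) + ereal (- dist p q))
        \<le> Liminf ?F (\<lambda>(n, m). ereal (gromov_product q (x n) (y m)))"
      by (intro Liminf_mono always_eventually) (simp add: case_prod_unfold)
    have "Liminf ?F (\<lambda>(n, m). ereal (gromov_product p (x n) (y m)) + ereal (- dist p q))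
        = Liminf ?F (\<lambda>(n, m). ereal (gromov_product p (x n) (y m))) + ereal (- dist p q)"
      unfolding case_prod_unfold
      by (rule Liminf_add_ereal_right) (simp_all add: prod_filter_eq_bot)
    also have "\<dots> = \<infinity>"
      using inf by (simp only: gromov_product_seq_def) simp
    finally show ?thesis
      using le by (simp only: gromov_product_seq_def) simp
  qed
  show ?thesis
    using imp by blast
qed

definition USq :: "(nat \<Rightarrow> 'a::metric_space) set" where
  "USq = {x. \<not> bounded (range x)}"

definition Sq_inf :: "'a::metric_space \<Rightarrow> (nat \<Rightarrow> 'a) set" where
  "Sq_inf x0 = {x \<in> USq. gromov_product_seq x0 x x = \<infinity>}"

definition Vis :: "'a::metric_space \<Rightarrow> (nat \<Rightarrow> 'a) \<Rightarrow> (nat \<Rightarrow> 'a) set" where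
  "Vis x0 x = {y \<in> Sq_inf x0. gromov_product_seq x0 y x = \<infinity>}"

definition asymp_conservative ::
    "'a::metric_space \<Rightarrow> 'b::metric_space \<Rightarrow> ('a \<Rightarrow> 'b) \<Rightarrow> bool" where
  "asymp_conservative x0 y0 \<omega> \<longleftrightarrow>
     (\<forall>x \<in> USq. (\<lambda>z. \<omega> \<circ> z) ` Vis x0 x \<subseteq> Vis y0 (\<omega> \<circ> x) \<and>
       (\<forall>z \<in> USq. \<omega> \<circ> z \<in> Vis y0 (\<omega> \<circ> x) \<longrightarrow> z \<in> Vis x0 x))"

definition close_at_infinity ::
    "'a::metric_space \<Rightarrow> 'b::metric_space \<Rightarrow> ('a \<Rightarrow> 'b) \<Rightarrow> ('a \<Rightarrow> 'b) \<Rightarrow> bool" where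
  "close_at_infinity x0 y0 \<omega>1 \<omega>2 \<longleftrightarrow>
     (\<forall>x1 \<in> Sq_inf x0. \<forall>x2 \<in> Sq_inf x0.
        Vis x0 x1 = Vis x0 x2 \<longrightarrow> Vis y0 (\<omega>1 \<circ> x1) = Vis y0 (\<omega>2 \<circ> x2))"

definition asymp_quasi_inverse ::
    "'a::metric_space \<Rightarrow> 'b::metric_space \<Rightarrow> ('a \<Rightarrow> 'b) \<Rightarrow> ('b \<Rightarrow> 'a) \<Rightarrow> bool" where
  "asymp_quasi_inverse x0 y0 \<omega> \<omega>' \<longleftrightarrow>
     asymp_conservative y0 x0 \<omega>' \<and>
     close_at_infinity x0 x0 (\<omega>' \<circ> \<omega>) id \<and> close_at_infinity y0 y0 (\<omega> \<circ> \<omega>') id"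

definition AC_inv :: "'a::metric_space \<Rightarrow> ('a \<Rightarrow> 'a) set" where
  "AC_inv x0 = {\<omega>. asymp_conservative x0 x0 \<omega> \<and> (\<exists>\<omega>'. asymp_quasi_inverse x0 x0 \<omega> \<omega>')}"

definition AC_inv_monoid :: "'a::metric_space \<Rightarrow> ('a \<Rightarrow> 'a) monoid" where
  "AC_inv_monoid x0 = \<lparr>carrier = AC_inv x0, mult = (\<circ>), one = id\<rparr>"

definition close_rel :: "'a::metric_space \<Rightarrow> (('a \<Rightarrow> 'a) \<times> ('a \<Rightarrow> 'a)) set" where
  "close_rel x0 = {(\<omega>1, \<omega>2). \<omega>1 \<in> AC_inv x0 \<and> \<omega>2 \<in> AC_inv x0 \<and> close_at_infinity x0 x0 \<omega>1 \<omega>2}"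

definition semigroup_congruence :: "('g, 'm) monoid_scheme \<Rightarrow> ('g \<times> 'g) set \<Rightarrow> bool" where
  "semigroup_congruence G r \<longleftrightarrow>
     equiv (carrier G) r \<and>
     (\<forall>x y z w. (x, y) \<in> r \<longrightarrow> (z, w) \<in> r \<longrightarrow> (x \<otimes>\<^bsub>G\<^esub> z, y \<otimes>\<^bsub>G\<^esub> w) \<in> r)"

text \<open>
  The union in the product ranges over all choices of representatives; for a congruence it is
  the single class \<open>[g\<^sub>1g\<^sub>2]\<close>, see below.
\<close>

definition quotient_monoid :: "('g, 'm) monoid_scheme \<Rightarrow> ('g \<times> 'g) set \<Rightarrow> 'g set monoid" where
  "quotient_monoid G r =
     \<lparr>carrier = carrier G // r,
      mult = (\<lambda>A B. \<Union>a\<in>A. \<Union>b\<in>B. r `` {a \<otimes>\<^bsub>G\<^esub> b}),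
      one = r `` {\<one>\<^bsub>G\<^esub>}\<rparr>"

lemma quotient_monoid_mult:
  assumes "semigroup_congruence G r" "g1 \<in> carrier G" "g2 \<in> carrier G"
  shows "(r `` {g1}) \<otimes>\<^bsub>quotient_monoid G r\<^esub> (r `` {g2}) = r `` {g1 \<otimes>\<^bsub>G\<^esub> g2}"
proof -
  have eq: "equiv (carrier G) r"
    and cong: "\<And>x y z w. (x, y) \<in> r \<Longrightarrow> (z, w) \<in> r \<Longrightarrow> (x \<otimes>\<^bsub>G\<^esub> z, y \<otimes>\<^bsub>G\<^esub> w) \<in> r"
    using assms(1) by (auto simp: semigroup_congruence_def)
  have "r `` {a \<otimes>\<^bsub>G\<^esub> b} = r `` {g1 \<otimes>\<^bsub>G\<^esub> g2}" if "a \<in> r `` {g1}" "b \<in> r `` {g2}" for a b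
    using equiv_class_eq[OF eq cong] that by blast
  moreover have "g1 \<in> r `` {g1}" "g2 \<in> r `` {g2}"
    using equiv_class_self[OF eq] assms(2,3) by auto
  ultimately have "(\<Union>a \<in> r `` {g1}. \<Union>b \<in> r `` {g2}. r `` {a \<otimes>\<^bsub>G\<^esub> b}) = r `` {g1 \<otimes>\<^bsub>G\<^esub> g2}"
    by blast
  then show ?thesis
    unfolding quotient_monoid_def monoid.select_convs .
qed

end

(* The key point is that an invertible asymptotically conservative map w satisfies
   z : Vis x <-> w o z : Vis (w o x) for all sequences z and x, bounded ones included. If w o z lies
   in Vis (w o x) while z or x is bounded, interleave that sequence with an unbounded one whose
   image is visible from the same sequence; condition (2) then makes the bounded sequence visible,
   which is absurd. Given this equivalence and a quasi-inverse w', visibility from w o x can be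
   tested after applying w', so w respects equality of visibility sets on Sq_inf, and every claim
   becomes a formal computation with the relation Vis x = Vis y. *)
theory Submission
  imports Defs
begin

section \<open>Infinite Gromov products and visibility\<close>

lemma gromov_product_seq_infinite_iff:
  "gromov_product_seq x0 x y = \<infinity> \<longleftrightarrow> (\<forall>C. \<exists>N. \<forall>n\<ge>N. \<forall>m\<ge>N. C < gromov_product x0 (x n) (y m))"
proof -
  \<comment> \<open>The product filter is not \<open>bot\<close>, so an infinite
    \<open>Liminf\<close> is the same as convergence to infinity.\<close>
  have "gromov_product_seq x0 x y = \<infinity> \<longleftrightarrow>
      ((\<lambda>(n, m). ereal (gromov_product x0 (x n) (y m))) \<longlongrightarrow> \<infinity>) (sequentially \<times>\<^sub>F sequentially)"
    unfolding gromov_product_seq_def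
    by (subst Liminf_PInfty) (simp_all add: prod_filter_eq_bot)
  also have "\<dots> \<longleftrightarrow> (\<forall>C. \<exists>N. \<forall>m\<ge>N. \<forall>n\<ge>N. C < gromov_product x0 (x n) (y m))"
    by (simp add: tendsto_PInfty case_prod_unfold eventually_prod_sequentially)
  finally show ?thesis
    by meson
qed

lemma gromov_product_commute: "gromov_product x0 x y = gromov_product x0 y x"
  by (simp add: gromov_product_def dist_commute)

lemma gromov_product_seq_infinite_commute:
  "gromov_product_seq x0 x y = \<infinity> \<longleftrightarrow> gromov_product_seq x0 y x = \<infinity>"
  unfolding gromov_product_seq_infinite_iff by (subst gromov_product_commute) meson

lemma gromov_product_le_dist: "gromov_product x0 x y \<le> dist x0 y"
  using dist_triangle[of x0 x y] by (simp add: gromov_product_def dist_commute)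

text \<open>By the triangle inequality the products are at most \<open>dist x0 (y m)\<close>, so a
  bounded \<open>y\<close> would bound them.\<close>

lemma USq_if_gromov_product_seq_infinite:
  assumes "gromov_product_seq x0 x y = \<infinity>"
  shows "y \<in> USq"
proof (rule ccontr)
  assume "y \<notin> USq"
  then obtain C where C: "\<And>n. dist x0 (y n) \<le> C"
    by (auto simp: USq_def bounded_any_center[of _ x0])
  obtain N where "\<And>n m. n \<ge> N \<Longrightarrow> m \<ge> N \<Longrightarrow> C < gromov_product x0 (x n) (y m)"
    using assms unfolding gromov_product_seq_infinite_iff by meson
  then show False
    using gromov_product_le_dist[of x0 "x N" "y N"] C[of N] by fastforce
qed

lemma mem_Sq_inf_iff: "x \<in> Sq_inf x0 \<longleftrightarrow> gromov_product_seq x0 x x = \<infinity>"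
  using USq_if_gromov_product_seq_infinite by (auto simp: Sq_inf_def)

lemma mem_Vis_iff:
  "y \<in> Vis x0 x \<longleftrightarrow> gromov_product_seq x0 y y = \<infinity> \<and> gromov_product_seq x0 y x = \<infinity>"
  by (auto simp: Vis_def mem_Sq_inf_iff)

lemma Vis_imp_USq: "y \<in> Vis x0 x \<Longrightarrow> x \<in> USq"
  using USq_if_gromov_product_seq_infinite by (auto simp: mem_Vis_iff)

lemma Vis_imp_Sq_inf: "y \<in> Vis x0 x \<Longrightarrow> y \<in> Sq_inf x0"
  by (simp add: Vis_def)

lemma Sq_inf_imp_USq: "x \<in> Sq_inf x0 \<Longrightarrow> x \<in> USq"
  by (simp add: Sq_inf_def)

lemma mem_Vis_self_iff: "x \<in> Vis x0 x \<longleftrightarrow> x \<in> Sq_inf x0"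
  by (simp add: mem_Vis_iff mem_Sq_inf_iff)

section \<open>Interleaved sequences\<close>

definition interleave :: "(nat \<Rightarrow> 'a) \<Rightarrow> (nat \<Rightarrow> 'a) \<Rightarrow> nat \<Rightarrow> 'a" where
  "interleave u v n = (if even n then u (n div 2) else v (n div 2))"

lemma comp_interleave: "f \<circ> interleave u v = interleave (f \<circ> u) (f \<circ> v)"
  by (auto simp: interleave_def)

lemma interleave_USq:
  assumes "v \<in> USq"
  shows "interleave u v \<in> USq"
proof -
  have "v n = interleave u v (2 * n + 1)" for n
    by (simp add: interleave_def)
  then have "range v \<subseteq> range (interleave u v)"
    by (metis image_subsetI rangeI)
  then show ?thesis
    using assms bounded_subset by (auto simp: USq_def)
qed

text \<open>Each component is a subsequence, and together the two exhaust the interleaving. Infinite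
  products thus need both components, while \<open>interleave_USq\<close> needs only one; this
  asymmetry is what brings bounded sequences within reach of condition (2).\<close>

lemma gromov_product_seq_interleave_right:
  "gromov_product_seq x0 x (interleave u v) = \<infinity> \<longleftrightarrow>
     gromov_product_seq x0 x u = \<infinity> \<and> gromov_product_seq x0 x v = \<infinity>"
proof (intro iffI conjI)
  assume inf: "gromov_product_seq x0 x (interleave u v) = \<infinity>"
  show "gromov_product_seq x0 x u = \<infinity>" "gromov_product_seq x0 x v = \<infinity>"
    unfolding gromov_product_seq_infinite_iff
  proof (safe)
    fix C
    obtain N where N: "\<And>n m. n \<ge> N \<Longrightarrow> m \<ge> N \<Longrightarrow> C < gromov_product x0 (x n) (interleave u v m)"
      using inf unfolding gromov_product_seq_infinite_iff by meson
    have "C < gromov_product x0 (x n) (u m)" "C < gromov_product x0 (x n) (v m)"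
      if "n \<ge> N" "m \<ge> N" for n m
      using N[of n "2 * m"] N[of n "2 * m + 1"] that by (simp_all add: interleave_def)
    then show "\<exists>N. \<forall>n\<ge>N. \<forall>m\<ge>N. C < gromov_product x0 (x n) (u m)"
      "\<exists>N. \<forall>n\<ge>N. \<forall>m\<ge>N. C < gromov_product x0 (x n) (v m)"
      by blast+
  qed
next
  assume inf: "gromov_product_seq x0 x u = \<infinity> \<and> gromov_product_seq x0 x v = \<infinity>"
  show "gromov_product_seq x0 x (interleave u v) = \<infinity>"
    unfolding gromov_product_seq_infinite_iff
  proof
    fix C
    obtain N M where
      N: "\<And>n m. n \<ge> N \<Longrightarrow> m \<ge> N \<Longrightarrow> C < gromov_product x0 (x n) (u m)" and
      M: "\<And>n m. n \<ge> M \<Longrightarrow> m \<ge> M \<Longrightarrow> C < gromov_product x0 (x n) (v m)"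
      using inf unfolding gromov_product_seq_infinite_iff by meson
    \<comment> \<open>The sum dominates both thresholds, and the factor 2 compensates for
      \<open>m div 2\<close>.\<close>
    have "C < gromov_product x0 (x n) (interleave u v m)"
      if "n \<ge> 2 * (N + M)" "m \<ge> 2 * (N + M)" for n m
      using N[of n "m div 2"] M[of n "m div 2"] that by (simp add: interleave_def)
    then show "\<exists>N. \<forall>n\<ge>N. \<forall>m\<ge>N. C < gromov_product x0 (x n) (interleave u v m)"
      by blast
  qed
qed

lemma gromov_product_seq_interleave_left:
  "gromov_product_seq x0 (interleave u v) x = \<infinity> \<longleftrightarrow>
     gromov_product_seq x0 u x = \<infinity> \<and> gromov_product_seq x0 v x = \<infinity>"
  using gromov_product_seq_interleave_right gromov_product_seq_infinite_commute by metis

lemma mem_Vis_interleave_iff: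
  "y \<in> Vis x0 (interleave u v) \<longleftrightarrow> y \<in> Vis x0 u \<and> y \<in> Vis x0 v"
  by (auto simp: mem_Vis_iff gromov_product_seq_interleave_right)

text \<open>The self-product splits into four products of components; the two mixed ones agree by
  symmetry.\<close>

lemma interleave_Sq_inf:
  assumes "u \<in> Sq_inf x0" "v \<in> Sq_inf x0" "u \<in> Vis x0 v"
  shows "interleave u v \<in> Sq_inf x0"
  using assms gromov_product_seq_infinite_commute[of x0 u v]
  by (simp add: mem_Sq_inf_iff mem_Vis_iff gromov_product_seq_interleave_left
      gromov_product_seq_interleave_right)

section \<open>Asymptotically conservative maps and invertible pairs\<close>

lemma asymp_conservative_VisI:
  assumes "asymp_conservative x0 y0 \<omega>" "z \<in> Vis x0 x"
  shows "\<omega> \<circ> z \<in> Vis y0 (\<omega> \<circ> x)"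
  using assms Vis_imp_USq[OF assms(2)] by (auto simp: asymp_conservative_def)

lemma asymp_conservative_VisD:
  assumes "asymp_conservative x0 y0 \<omega>" "x \<in> USq" "z \<in> USq" "\<omega> \<circ> z \<in> Vis y0 (\<omega> \<circ> x)"
  shows "z \<in> Vis x0 x"
  using assms by (auto simp: asymp_conservative_def)

lemma asymp_conservative_Sq_inf:
  assumes "asymp_conservative x0 y0 \<omega>" "x \<in> Sq_inf x0"
  shows "\<omega> \<circ> x \<in> Sq_inf y0"
  using asymp_conservative_VisI[OF assms(1)] assms(2) by (metis mem_Vis_self_iff)

lemma close_at_infinityD:
  assumes "close_at_infinity x0 y0 \<omega>1 \<omega>2" "x \<in> Sq_inf x0"
  shows "Vis y0 (\<omega>1 \<circ> x) = Vis y0 (\<omega>2 \<circ> x)"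
  using assms by (auto simp: close_at_infinity_def)

text \<open>Naming the quasi-inverse makes the notion symmetric, so every result about
  \<open>\<omega>\<close> also holds for \<open>\<omega>'\<close>.\<close>

definition asymp_invertible ::
    "'a::metric_space \<Rightarrow> 'b::metric_space \<Rightarrow> ('a \<Rightarrow> 'b) \<Rightarrow> ('b \<Rightarrow> 'a) \<Rightarrow> bool" where
  "asymp_invertible x0 y0 \<omega> \<omega>' \<longleftrightarrow> asymp_conservative x0 y0 \<omega> \<and> asymp_quasi_inverse x0 y0 \<omega> \<omega>'"

lemma asymp_invertible_sym: "asymp_invertible x0 y0 \<omega> \<omega>' \<Longrightarrow> asymp_invertible y0 x0 \<omega>' \<omega>"
  by (auto simp: asymp_invertible_def asymp_quasi_inverse_def)

lemma asymp_invertible_conservative: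
  "asymp_invertible x0 y0 \<omega> \<omega>' \<Longrightarrow> asymp_conservative x0 y0 \<omega>"
  by (simp add: asymp_invertible_def)

lemma asymp_invertible_Vis_inverse:
  assumes "asymp_invertible x0 y0 \<omega> \<omega>'" "x \<in> Sq_inf x0"
  shows "Vis x0 (\<omega>' \<circ> (\<omega> \<circ> x)) = Vis x0 x"
  using assms close_at_infinityD[of x0 x0 "\<omega>' \<circ> \<omega>" id]
  by (simp add: asymp_invertible_def asymp_quasi_inverse_def comp_assoc)

lemma asymp_invertible_USq:
  assumes inv: "asymp_invertible x0 y0 \<omega> \<omega>'" and z: "\<omega> \<circ> z \<in> Sq_inf y0"
  shows "z \<in> USq"
proof -
  note cons = asymp_invertible_conservative[OF inv]
  \<comment> \<open>This is the unbounded companion for \<open>z\<close>: its image under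
    \<open>\<omega>\<close> has the same visibility set as
    \<open>\<omega> \<circ> z\<close>.\<close>
  let ?v = "\<omega>' \<circ> (\<omega> \<circ> z)"
  have v: "?v \<in> Sq_inf x0"
    using asymp_conservative_Sq_inf asymp_invertible_conservative asymp_invertible_sym inv z
    by blast
  have "\<omega> \<circ> z \<in> Vis y0 (\<omega> \<circ> ?v)"
    using asymp_invertible_Vis_inverse[OF asymp_invertible_sym[OF inv] z] z
    by (simp add: mem_Vis_self_iff)
  then have "\<omega> \<circ> interleave z ?v \<in> Sq_inf y0"
    unfolding comp_interleave
    using interleave_Sq_inf asymp_conservative_Sq_inf[OF cons v] z by blast
  \<comment> \<open>Condition (2) is applied to the interleaving against itself; it is unbounded
    thanks to \<open>?v\<close>. Being visible from the interleaving then means being visible from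
    \<open>z\<close>, which forces \<open>z\<close> to be unbounded.\<close>
  then have "interleave z ?v \<in> Vis x0 (interleave z ?v)"
    using asymp_conservative_VisD[OF cons] interleave_USq[OF Sq_inf_imp_USq[OF v]]
    unfolding mem_Vis_self_iff[symmetric] by blast
  then show ?thesis
    unfolding mem_Vis_interleave_iff using Vis_imp_USq by blast
qed

lemma asymp_invertible_Vis_iff:
  assumes inv: "asymp_invertible x0 y0 \<omega> \<omega>'"
  shows "\<omega> \<circ> z \<in> Vis y0 (\<omega> \<circ> x) \<longleftrightarrow> z \<in> Vis x0 x"
proof
  note cons = asymp_invertible_conservative[OF inv]
  assume Vis: "\<omega> \<circ> z \<in> Vis y0 (\<omega> \<circ> x)"
  then have z: "\<omega> \<circ> z \<in> Sq_inf y0"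
    by (rule Vis_imp_Sq_inf)
  then have USq: "z \<in> USq"
    by (rule asymp_invertible_USq[OF inv])
  \<comment> \<open>Here \<open>x\<close> may be bounded. Mixing in \<open>z\<close> repairs this
    and keeps visibility, since \<open>\<omega> \<circ> z\<close> is visible from itself.\<close>
  have "\<omega> \<circ> z \<in> Vis y0 (\<omega> \<circ> interleave x z)"
    unfolding comp_interleave mem_Vis_interleave_iff using Vis z
    by (simp add: mem_Vis_self_iff)
  then have "z \<in> Vis x0 (interleave x z)"
    using asymp_conservative_VisD[OF cons interleave_USq[OF USq] USq] by blast
  then show "z \<in> Vis x0 x"
    by (simp add: mem_Vis_interleave_iff)
qed (rule asymp_conservative_VisI[OF asymp_invertible_conservative[OF inv]])

text \<open>Applying \<open>\<omega>'\<close> turns visibility of \<open>y\<close> from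
  \<open>\<omega> \<circ> x\<close> into visibility of \<open>\<omega>' \<circ> y\<close> from
  \<open>x\<close>, a condition that depends on \<open>x\<close> only through
  \<open>Vis x0 x\<close>. As \<open>y\<close> is arbitrary, the equivalence for all sequences is
  essential.\<close>

lemma asymp_invertible_Vis_cong:
  assumes inv: "asymp_invertible x0 y0 \<omega> \<omega>'"
    and x: "x1 \<in> Sq_inf x0" "x2 \<in> Sq_inf x0" "Vis x0 x1 = Vis x0 x2"
  shows "Vis y0 (\<omega> \<circ> x1) = Vis y0 (\<omega> \<circ> x2)"
proof -
  have "y \<in> Vis y0 (\<omega> \<circ> x) \<longleftrightarrow> \<omega>' \<circ> y \<in> Vis x0 x" if "x \<in> Sq_inf x0" for x y
    using asymp_invertible_Vis_iff[OF asymp_invertible_sym[OF inv], of y "\<omega> \<circ> x"]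
    unfolding asymp_invertible_Vis_inverse[OF inv that] by (rule sym)
  then show ?thesis
    using x by blast
qed

text \<open>Congruence of \<open>\<omega>\<close> replaces \<open>x1\<close> by \<open>x2\<close>,
  so a comparison along a single sequence suffices.\<close>

lemma close_at_infinityI:
  assumes "asymp_invertible x0 y0 \<omega> \<omega>'"
    and "\<And>x. x \<in> Sq_inf x0 \<Longrightarrow> Vis y0 (\<omega> \<circ> x) = Vis y0 (\<rho> \<circ> x)"
  shows "close_at_infinity x0 y0 \<omega> \<rho>"
  unfolding close_at_infinity_def
proof (intro ballI impI)
  fix x1 x2
  assume x: "x1 \<in> Sq_inf x0" "x2 \<in> Sq_inf x0" "Vis x0 x1 = Vis x0 x2"
  show "Vis y0 (\<omega> \<circ> x1) = Vis y0 (\<rho> \<circ> x2)"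
    using asymp_invertible_Vis_cong[OF assms(1) x] assms(2)[OF x(2)] by (rule trans)
qed

section \<open>Identity and composition\<close>

lemma asymp_invertible_id: "asymp_invertible x0 x0 id id"
  by (auto simp: asymp_invertible_def asymp_quasi_inverse_def asymp_conservative_def
      close_at_infinity_def)

text \<open>The definition does not say that \<open>\<omega> \<circ> x\<close> is unbounded when
  \<open>x\<close> is; chaining the two equivalences for arbitrary sequences avoids the
  question.\<close>

lemma asymp_conservative_comp:
  assumes "asymp_invertible x0 y0 \<omega> \<omega>'" "asymp_invertible y0 z0 \<rho> \<rho>'"
  shows "asymp_conservative x0 z0 (\<rho> \<circ> \<omega>)"
  unfolding asymp_conservative_def
  by (auto simp: comp_assoc asymp_invertible_Vis_iff[OF assms(1)] asymp_invertible_Vis_iff[OF assms(2)])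

text \<open>The inner pair \<open>\<rho>' \<circ> \<rho>\<close> is cancelled first, under
  \<open>\<omega>'\<close>, which respects equality of visibility sets; then the outer pair is
  cancelled.\<close>

lemma close_at_infinity_comp_inverse:
  assumes \<omega>: "asymp_invertible x0 y0 \<omega> \<omega>'" and \<rho>: "asymp_invertible y0 z0 \<rho> \<rho>'"
  shows "close_at_infinity x0 x0 ((\<omega>' \<circ> \<rho>') \<circ> (\<rho> \<circ> \<omega>)) id"
  unfolding close_at_infinity_def
proof (intro ballI impI)
  fix x1 x2
  assume x: "x1 \<in> Sq_inf x0" "x2 \<in> Sq_inf x0" "Vis x0 x1 = Vis x0 x2"
  have \<omega>x: "\<omega> \<circ> x1 \<in> Sq_inf y0"
    by (rule asymp_conservative_Sq_inf[OF asymp_invertible_conservative[OF \<omega>] x(1)])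
  have "\<rho> \<circ> (\<omega> \<circ> x1) \<in> Sq_inf z0"
    by (rule asymp_conservative_Sq_inf[OF asymp_invertible_conservative[OF \<rho>] \<omega>x])
  then have "\<rho>' \<circ> (\<rho> \<circ> (\<omega> \<circ> x1)) \<in> Sq_inf y0"
    by (rule asymp_conservative_Sq_inf[OF
          asymp_invertible_conservative[OF asymp_invertible_sym[OF \<rho>]]])
  then have "Vis x0 (\<omega>' \<circ> (\<rho>' \<circ> (\<rho> \<circ> (\<omega> \<circ> x1)))) = Vis x0 (\<omega>' \<circ> (\<omega> \<circ> x1))"
    by (rule asymp_invertible_Vis_cong[OF asymp_invertible_sym[OF \<omega>] _ \<omega>x
          asymp_invertible_Vis_inverse[OF \<rho> \<omega>x]])
  also have "\<dots> = Vis x0 x2"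
    using asymp_invertible_Vis_inverse[OF \<omega> x(1)] x(3) by simp
  finally show "Vis x0 ((\<omega>' \<circ> \<rho>') \<circ> (\<rho> \<circ> \<omega>) \<circ> x1) = Vis x0 (id \<circ> x2)"
    by (simp add: comp_assoc)
qed

lemma asymp_invertible_comp:
  assumes \<omega>: "asymp_invertible x0 y0 \<omega> \<omega>'" and \<rho>: "asymp_invertible y0 z0 \<rho> \<rho>'"
  shows "asymp_invertible x0 z0 (\<rho> \<circ> \<omega>) (\<omega>' \<circ> \<rho>')"
  unfolding asymp_invertible_def asymp_quasi_inverse_def
  by (intro conjI asymp_conservative_comp[OF \<omega> \<rho>]
      asymp_conservative_comp[OF asymp_invertible_sym[OF \<rho>] asymp_invertible_sym[OF \<omega>]]
      close_at_infinity_comp_inverse[OF \<omega> \<rho>]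
      close_at_infinity_comp_inverse[OF asymp_invertible_sym[OF \<rho>] asymp_invertible_sym[OF \<omega>]])

section \<open>The monoid, the congruence and the quotient group\<close>

lemma mem_AC_inv_iff: "\<omega> \<in> AC_inv x0 \<longleftrightarrow> (\<exists>\<omega>'. asymp_invertible x0 x0 \<omega> \<omega>')"
  by (auto simp: AC_inv_def asymp_invertible_def)

lemma id_mem_AC_inv: "id \<in> AC_inv x0"
  using asymp_invertible_id mem_AC_inv_iff by blast

lemma comp_mem_AC_inv: "\<omega> \<in> AC_inv x0 \<Longrightarrow> \<rho> \<in> AC_inv x0 \<Longrightarrow> \<omega> \<circ> \<rho> \<in> AC_inv x0"
  using asymp_invertible_comp unfolding mem_AC_inv_iff by blast

lemma monoid_AC_inv: "Group.monoid (AC_inv_monoid x0)"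
  by (rule monoidI) (simp_all add: AC_inv_monoid_def comp_assoc comp_mem_AC_inv id_mem_AC_inv)

text \<open>Closeness becomes equality of a function of each map separately, so the equivalence laws
  are immediate.\<close>

lemma mem_close_rel_iff:
  "(\<omega>, \<rho>) \<in> close_rel x0 \<longleftrightarrow> \<omega> \<in> AC_inv x0 \<and> \<rho> \<in> AC_inv x0 \<and>
     (\<forall>x\<in>Sq_inf x0. Vis x0 (\<omega> \<circ> x) = Vis x0 (\<rho> \<circ> x))"
proof -
  have "close_at_infinity x0 x0 \<omega> \<rho> \<longleftrightarrow> (\<forall>x\<in>Sq_inf x0. Vis x0 (\<omega> \<circ> x) = Vis x0 (\<rho> \<circ> x))"
    if "\<omega> \<in> AC_inv x0"
    using that close_at_infinityI close_at_infinityD unfolding mem_AC_inv_iff by meson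
  then show ?thesis
    by (auto simp: close_rel_def)
qed

lemma semigroup_congruence_close_rel: "semigroup_congruence (AC_inv_monoid x0) (close_rel x0)"
proof -
  have "equiv (AC_inv x0) (close_rel x0)"
    by (intro equivI refl_onI symI transI) (auto simp: mem_close_rel_iff)
  moreover have "(a \<circ> c, b \<circ> d) \<in> close_rel x0"
    if ab: "(a, b) \<in> close_rel x0" and cd: "(c, d) \<in> close_rel x0" for a b c d
    unfolding mem_close_rel_iff
  proof (intro conjI ballI)
    show "a \<circ> c \<in> AC_inv x0" "b \<circ> d \<in> AC_inv x0"
      using ab cd by (simp_all add: mem_close_rel_iff comp_mem_AC_inv)
    fix x
    assume x: "x \<in> Sq_inf x0"
    obtain b' where b': "asymp_invertible x0 x0 b b'"
      using ab by (auto simp: mem_close_rel_iff mem_AC_inv_iff)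
    have cx: "c \<circ> x \<in> Sq_inf x0" and dx: "d \<circ> x \<in> Sq_inf x0"
      using cd x by (auto simp: mem_close_rel_iff mem_AC_inv_iff
          intro: asymp_conservative_Sq_inf asymp_invertible_conservative)
    have "Vis x0 (a \<circ> (c \<circ> x)) = Vis x0 (b \<circ> (c \<circ> x))"
      using ab cx by (simp add: mem_close_rel_iff)
    \<comment> \<open>Invertibility of \<open>b\<close> enters here: it respects the equality of the
      visibility sets of \<open>c \<circ> x\<close> and \<open>d \<circ> x\<close>.\<close>
    also have "\<dots> = Vis x0 (b \<circ> (d \<circ> x))"
      using asymp_invertible_Vis_cong[OF b' cx dx] cd x by (simp add: mem_close_rel_iff)
    finally show "Vis x0 (a \<circ> c \<circ> x) = Vis x0 (b \<circ> d \<circ> x)"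
      by (simp add: comp_assoc)
  qed
  ultimately show ?thesis
    by (simp add: semigroup_congruence_def AC_inv_monoid_def)
qed

text \<open>Left inverses modulo \<open>r\<close> become left inverses of classes, as
  \<open>groupI\<close> asks; the remaining axioms pass to classes through representatives.\<close>

lemma group_quotient_monoid:
  fixes G :: "('g, 'm) monoid_scheme" (structure)
  assumes "Group.monoid G" and cong: "semigroup_congruence G r"
    and inverse: "\<And>g. g \<in> carrier G \<Longrightarrow> \<exists>h\<in>carrier G. (h \<otimes> g, \<one>) \<in> r"
  shows "Group.group (quotient_monoid G r)"
proof -
  interpret Group.monoid G by fact
  let ?Q = "quotient_monoid G r"
  have equiv: "equiv (carrier G) r"
    using cong by (simp add: semigroup_congruence_def)
  have carrier: "A \<in> carrier ?Q \<longleftrightarrow> (\<exists>g\<in>carrier G. A = r `` {g})" for A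
    by (auto simp: quotient_monoid_def quotient_def)
  have one: "\<one>\<^bsub>?Q\<^esub> = r `` {\<one>}"
    by (simp add: quotient_monoid_def)
  note mult = quotient_monoid_mult[OF cong]
  show ?thesis
  proof (rule groupI)
    show "\<exists>B\<in>carrier ?Q. B \<otimes>\<^bsub>?Q\<^esub> A = \<one>\<^bsub>?Q\<^esub>" if A: "A \<in> carrier ?Q" for A
    proof -
      obtain g where g: "g \<in> carrier G" "A = r `` {g}"
        using A carrier by blast
      obtain h where "h \<in> carrier G" "(h \<otimes> g, \<one>) \<in> r"
        using inverse[OF g(1)] by blast
      then show ?thesis
        using g carrier mult one equiv_class_eq[OF equiv] by metis
    qed
  qed (auto simp: carrier one mult m_assoc)
qed

theorem theorem1:
  fixes x0 :: "'a::metric_space"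
  assumes "\<not> bounded (UNIV :: 'a set)"
  shows "Group.monoid (AC_inv_monoid x0) \<and>
    semigroup_congruence (AC_inv_monoid x0) (close_rel x0) \<and>
    Group.group (quotient_monoid (AC_inv_monoid x0) (close_rel x0))"
proof (intro conjI monoid_AC_inv semigroup_congruence_close_rel
    group_quotient_monoid[OF monoid_AC_inv semigroup_congruence_close_rel])
  fix \<omega>
  assume "\<omega> \<in> carrier (AC_inv_monoid x0)"
  then obtain \<omega>' where inv: "asymp_invertible x0 x0 \<omega> \<omega>'"
    by (auto simp: AC_inv_monoid_def mem_AC_inv_iff)
  \<comment> \<open>By symmetry the quasi-inverse is itself invertible, and it serves as the left
    inverse of \<open>\<omega>\<close> modulo closeness.\<close>
  have "\<omega>' \<in> AC_inv x0" "\<omega> \<in> AC_inv x0"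
    using inv asymp_invertible_sym[OF inv] unfolding mem_AC_inv_iff by blast+
  then show "\<exists>\<rho>\<in>carrier (AC_inv_monoid x0).
      (\<rho> \<otimes>\<^bsub>AC_inv_monoid x0\<^esub> \<omega>, \<one>\<^bsub>AC_inv_monoid x0\<^esub>) \<in> close_rel x0"
    using asymp_invertible_Vis_inverse[OF inv]
    by (auto simp: AC_inv_monoid_def mem_close_rel_iff comp_assoc comp_mem_AC_inv id_mem_AC_inv)
qed

end
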